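(* Let $m\ge 2$ and let $n$ be a multiple of $m$ with $n > 4m^2-6m$. Then every $n$-vertex tournament has an $m$-star-factor.
   Context: A tournament is an orientation of a complete graph. For $m\ge 2$, the $m$-star $S_m$ is the digraph on $m$ vertices consisting of $m-1$ edges with a common tail (the source) and $m-1$ distinct heads. For a tournament $T$ on $n$ vertices with $m \mid n$, an $m$-star-factor of $T$ is a spanning subgraph of $T$ consisting of $n/m$ pairwise vertex-disjoint copies of $S_m$. *)

theory Defs
  imports "Graph_Theory.Graph_Theory"
begin

locale tournament = digraph T for T :: "('a, 'b) pre_digraph" (structure) +
  assumes one_direction:
    "\<lbrakk>u \<in> verts T; v \<in> verts T; u \<noteq> v\<rbrakk> \<Longrightarrow> (u \<rightarrow> v) \<noteq> (v \<rightarrow> u)"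

text \<open>The star on \<open>m\<close> vertices, with source \<open>0\<close> and leaves \<open>1, \<dots>, m - 1\<close>.\<close>

definition m_star :: "nat \<Rightarrow> (nat, nat \<times> nat) pre_digraph" where
  "m_star m = with_proj \<lparr> pverts = {0..<m}, parcs = {0} \<times> {1..<m} \<rparr>"

definition m_star_factor :: "nat \<Rightarrow> ('a, 'b) pre_digraph \<Rightarrow> ('a, 'b) pre_digraph \<Rightarrow> bool" where
  "m_star_factor m F T \<longleftrightarrow>
     m dvd card (verts T) \<and>
     spanning F T \<and>
     (\<exists>\<H>. finite \<H> \<and> card \<H> = card (verts T) div m \<and>
          (\<forall>H \<in> \<H>. subgraph H T \<and> digraph_iso (m_star m) H) \<and>
          pairwise (\<lambda>H H'. verts H \<inter> verts H' = {}) \<H> \<and>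
          F = pre_digraph.Union T \<H>)"

end

theory Submission
  imports Defs
begin

text \<open>
  A set of at least \<open>2m - 2\<close> vertices contains an \<open>m\<close>-star, by averaging out-degrees. Let \<open>w\<close> be
  a vertex of maximum out-degree, so that its out-neighbourhood \<open>W\<close> has at least \<open>m(2m - 3)\<close>
  vertices. Remove stars greedily from the vertices outside \<open>W \<union> {w}\<close> until a set \<open>L\<close> of at most
  \<open>2m - 3\<close> vertices is left. Each \<open>v \<in> L\<close> in turn is put into a star whose other \<open>m - 1\<close> vertices
  come from \<open>W\<close>: either \<open>v\<close> dominates \<open>m - 1\<close> of the remaining vertices of \<open>W\<close>, or so many of them
  dominate \<open>v\<close> that they contain an \<open>(m-1)\<close>-star, to which \<open>v\<close> is added as a leaf. Finally remove
  stars greedily from what remains of \<open>W\<close>; by divisibility exactly \<open>m - 1\<close> vertices survive, and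
  they form a star with source \<open>w\<close>.
\<close>

section \<open>Averaging out-degrees\<close>

text \<open>By totality, the dominance pairs \<open>?E\<close>, their converse and the diagonal
  cover \<open>U \<times> U\<close>. Hence the terms \<open>2 * card (N c) + 1\<close> sum to at
  least the square of \<open>card U\<close>, and they cannot all lie below
  \<open>card U\<close>.\<close>

lemma ex_large_out_degree:
  assumes "totalp_on U R" "finite U" "U \<noteq> {}"
  shows "\<exists>c\<in>U. card U \<le> 2 * card {a\<in>U. a \<noteq> c \<and> R c a} + 1"
proof (rule ccontr)
  assume *: "\<not> ?thesis"
  define N where "N c = {a\<in>U. a \<noteq> c \<and> R c a}" for c
  let ?E = "Sigma U N" and ?D = "(\<lambda>x. (x, x)) ` U"
  have fin: "finite ?E" "finite ?D" "finite (?E\<inverse>)"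
    using assms(2) by (auto simp: N_def)
  have "U \<times> U \<subseteq> ?E \<union> ?E\<inverse> \<union> ?D"
    using assms(1) by (fastforce simp: N_def totalp_on_def)
  then have "card (U \<times> U) \<le> card (?E \<union> ?E\<inverse> \<union> ?D)"
    using fin by (intro card_mono) auto
  also have "\<dots> \<le> card ?E + card (?E\<inverse>) + card ?D"
    by (meson add_mono card_Un_le order_refl order_trans)
  also have "card ?D = card U"
    by (intro card_image) (auto simp: inj_on_def)
  also have "card (?E\<inverse>) = card ?E"
    by simp
  also have "card ?E = (\<Sum>c\<in>U. card (N c))"
    using assms(2) by (subst card_SigmaI) (auto simp: N_def)
  finally have "card U * card U \<le> (\<Sum>c\<in>U. 2 * card (N c) + 1)"
    by (simp add: card_cartesian_product sum.distrib sum_distrib_left mult_2 sum_Suc)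
  also have "\<dots> < (\<Sum>c\<in>U. card U)"
    using assms * by (intro sum_strict_mono) (auto simp: N_def not_le)
  finally show False
    by simp
qed

lemma ex_star:
  assumes "totalp_on U R" "finite U" "U \<noteq> {}" "2 * p \<le> card U"
  obtains c A where "c \<in> U" "A \<subseteq> U" "c \<notin> A" "card A = p" "\<And>a. a \<in> A \<Longrightarrow> R c a"
proof -
  obtain c where c: "c \<in> U" "card U \<le> 2 * card {a\<in>U. a \<noteq> c \<and> R c a} + 1"
    using ex_large_out_degree[OF assms(1-3)] by blast
  \<comment> \<open>By parity, \<open>2 * p \<le> 2 * d + 1\<close> already forces
    \<open>p \<le> d\<close>, so \<open>2 * p\<close> vertices suffice.\<close>
  then have "p \<le> card {a\<in>U. a \<noteq> c \<and> R c a}"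
    using assms(4) by linarith
  then obtain A where "A \<subseteq> {a\<in>U. a \<noteq> c \<and> R c a}" "card A = p"
    by (meson obtain_subset_with_card_n)
  with c(1) show ?thesis
    by (intro that[of c A]) auto
qed

section \<open>Vertex sets that split into stars\<close>

text \<open>The parameter \<open>p\<close> is the number of leaves, so that \<open>m = p + 1\<close>.\<close>

inductive star_tileable :: "nat \<Rightarrow> ('a \<Rightarrow> 'a \<Rightarrow> bool) \<Rightarrow> 'a set \<Rightarrow> bool" for p R where
  empty: "star_tileable p R {}"
| insert: "star_tileable p R U \<Longrightarrow> finite A \<Longrightarrow> card A = p \<Longrightarrow> c \<notin> A \<Longrightarrow>
    (\<And>a. a \<in> A \<Longrightarrow> R c a) \<Longrightarrow> insert c A \<inter> U = {} \<Longrightarrow> star_tileable p R (insert c A \<union> U)"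

lemma star_tileable_finite: "star_tileable p R U \<Longrightarrow> finite U"
  by (induction rule: star_tileable.induct) auto

lemma star_tileable_dvd_card: "star_tileable p R U \<Longrightarrow> (p + 1) dvd card U"
proof (induction rule: star_tileable.induct)
  case (insert U A c)
  then have "card (insert c A \<union> U) = (p + 1) + card U"
    by (subst card_Un_disjoint) (auto dest: star_tileable_finite)
  with insert.IH show ?case
    by (simp only: dvd_add_triv_left_iff)
qed simp

lemma star_tileable_star:
  assumes "finite A" "card A = p" "c \<notin> A" "\<And>a. a \<in> A \<Longrightarrow> R c a"
  shows "star_tileable p R (insert c A)"
  using star_tileable.insert[of p R "{}" A c] star_tileable.empty assms by auto

lemma star_tileable_Un:
  assumes "star_tileable p R U" "star_tileable p R U'" "U \<inter> U' = {}"
  shows "star_tileable p R (U \<union> U')"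
  using assms
proof (induction rule: star_tileable.induct)
  case (insert U A c)
  then have "star_tileable p R (insert c A \<union> (U \<union> U'))"
    by (intro star_tileable.insert) auto
  then show ?case
    by (simp add: Un_assoc)
qed simp

lemma star_tileable_greedy:
  assumes "totalp_on U R" "finite U" "p \<ge> 1"
  obtains L where "L \<subseteq> U" "card L < 2 * p" "star_tileable p R (U - L)"
proof -
  have "\<exists>L\<subseteq>U. card L < 2 * p \<and> star_tileable p R (U - L)"
    using assms(2,1)
  proof (induction rule: finite_psubset_induct)
    case (psubset U)
    show ?case
    proof (cases "card U < 2 * p")
      case True
      then show ?thesis
        by (intro exI[of _ U]) (auto intro: star_tileable.empty)
    next
      case False
      then have "U \<noteq> {}" "2 * p \<le> card U"
        using assms(3) by auto
      then obtain c A where cA: "c \<in> U" "A \<subseteq> U" "c \<notin> A" "card A = p" "\<And>a. a \<in> A \<Longrightarrow> R c a"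
        using ex_star[OF psubset.prems psubset.hyps, of p] by metis
      let ?S = "insert c A"
      have "U - ?S \<subset> U" "totalp_on (U - ?S) R"
        using cA psubset.prems by (auto simp: totalp_on_def)
      then obtain L where L: "L \<subseteq> U - ?S" "card L < 2 * p" "star_tileable p R (U - ?S - L)"
        using psubset.IH[of "U - ?S"] by metis
      have "star_tileable p R (?S \<union> (U - ?S - L))"
        using L cA psubset.hyps
        by (intro star_tileable_Un star_tileable_star) (auto intro: finite_subset)
      moreover have "?S \<union> (U - ?S - L) = U - L"
        using cA L(1) by auto
      ultimately show ?thesis
        using L by auto
    qed
  qed
  then show ?thesis
    using that by blast
qed

section \<open>Absorbing leftover vertices\<close>

text \<open>The threshold is \<open>(p - 1) + 2 * p\<close>: if \<open>v\<close> dominates at most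
  \<open>p - 1\<close> vertices of \<open>W\<close>, then at least \<open>2 * p\<close> others
  remain, and by totality these dominate \<open>v\<close>.\<close>

lemma star_tileable_absorb_vertex:
  assumes "totalp_on (insert v W) R" "finite W" "v \<notin> W" "p \<ge> 1" "3 * p - 1 \<le> card W"
  obtains A where "A \<subseteq> W" "card A = p" "star_tileable p R (insert v A)"
proof (cases "p \<le> card {a\<in>W. R v a}")
  case True
  then obtain A where A: "A \<subseteq> {a\<in>W. R v a}" "card A = p"
    by (meson obtain_subset_with_card_n)
  moreover have "star_tileable p R (insert v A)"
    using A assms(2,3) by (intro star_tileable_star) (auto intro: finite_subset)
  ultimately show ?thesis
    by (intro that[of A]) auto
next
  case False
  define I where "I = W - {a\<in>W. R v a}"
  have "card I = card W - card {a\<in>W. R v a}"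
    unfolding I_def using assms(2) by (intro card_Diff_subset) auto
  then have "2 * p \<le> card I"
    using False assms(5) by linarith
  \<comment> \<open>Only \<open>p - 1\<close> leaves are sought, because \<open>v\<close> will be
    the last one. Nonemptiness is stated separately since for \<open>p = 1\<close> the size bound is
    vacuous.\<close>
  then have "2 * (p - 1) \<le> card I" "I \<noteq> {}"
    using assms(4) by auto
  moreover have "totalp_on I R" "finite I"
    using assms(1,2) by (auto simp: I_def totalp_on_def)
  ultimately obtain c A where cA: "c \<in> I" "A \<subseteq> I" "c \<notin> A" "card A = p - 1"
    "\<And>a. a \<in> A \<Longrightarrow> R c a"
    using ex_star[of I R "p - 1"] by metis
  have fin: "finite A"
    using cA(2) \<open>finite I\<close> by (rule finite_subset)
  have "R c v"
    using cA(1) assms(1,3) by (auto simp: I_def totalp_on_def)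
  moreover have "v \<notin> A" "c \<noteq> v"
    using cA(1,2) assms(3) by (auto simp: I_def)
  ultimately have "star_tileable p R (insert c (insert v A))"
    using cA fin assms(4) by (intro star_tileable_star) auto
  then have "star_tileable p R (insert v (insert c A))"
    by (simp add: insert_commute)
  moreover have "card (insert c A) = p"
    using cA(3,4) fin assms(4) by simp
  ultimately show ?thesis
    using cA(1,2) by (intro that[of "insert c A"]) (auto simp: I_def)
qed

text \<open>Absorbing one vertex lowers both sides of the size bound by \<open>p\<close>, so the
  bound is preserved. While \<open>L\<close> is nonempty it leaves at least \<open>3 * p - 1\<close>
  vertices in \<open>W\<close>, as \<open>star_tileable_absorb_vertex\<close> demands.\<close>

lemma star_tileable_absorb:
  assumes "finite L" "totalp_on (L \<union> W) R" "finite W" "L \<inter> W = {}" "p \<ge> 1"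
    "p * card L + 2 * p - 1 \<le> card W"
  shows "\<exists>B\<subseteq>W. card B = p * card L \<and> star_tileable p R (L \<union> B)"
  using assms
proof (induction L arbitrary: W rule: finite_induct)
  case empty
  then show ?case
    by (intro exI[of _ "{}"]) (auto intro: star_tileable.empty)
next
  case (insert v L)
  have "totalp_on (insert v W) R"
    using insert.prems(1) by (auto simp: totalp_on_def)
  moreover have "3 * p - 1 \<le> card W"
    using insert.prems(5) insert.hyps by (simp add: algebra_simps)
  ultimately obtain A where A: "A \<subseteq> W" "card A = p" "star_tileable p R (insert v A)"
    using insert.prems star_tileable_absorb_vertex[of v W R p] by blast
  have fin: "finite A"
    using A insert.prems(2) by (meson finite_subset)
  have "card (W - A) = card W - p"
    using A fin by (simp add: card_Diff_subset)
  then have "p * card L + 2 * p - 1 \<le> card (W - A)"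
    using insert.prems(5) insert.hyps by (simp add: algebra_simps)
  moreover have "totalp_on (L \<union> (W - A)) R"
    using insert.prems(1) by (auto simp: totalp_on_def)
  ultimately obtain B where B: "B \<subseteq> W - A" "card B = p * card L" "star_tileable p R (L \<union> B)"
    using insert.IH[of "W - A"] insert.prems by auto
  have "star_tileable p R (insert v A \<union> (L \<union> B))"
    using A(1) B(1) insert.prems(3) insert.hyps by (intro star_tileable_Un[OF A(3) B(3)]) auto
  moreover have "insert v A \<union> (L \<union> B) = insert v L \<union> (A \<union> B)"
    by auto
  moreover have "card (A \<union> B) = p * card (insert v L)"
    using A B fin insert.prems(2) insert.hyps
    by (subst card_Un_disjoint) (auto intro: finite_subset)
  ultimately show ?case
    using A B by (intro exI[of _ "A \<union> B"]) auto
qed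

section \<open>Tiling the whole vertex set\<close>

lemma star_tileable_total:
  assumes "totalp_on V R" "finite V" "p \<ge> 1" "(p + 1) dvd card V"
    and large: "card V > 2 * (p + 1) * (2 * p - 1)"
  shows "star_tileable p R V"
proof -
  have "V \<noteq> {}"
    using large by auto
  then obtain w where w: "w \<in> V" "card V \<le> 2 * card {a\<in>V. a \<noteq> w \<and> R w a} + 1"
    using ex_large_out_degree[OF assms(1,2)] by blast
  define W where "W = {a\<in>V. a \<noteq> w \<and> R w a}"
  have W: "W \<subseteq> V" "w \<notin> W" "finite W" "\<And>a. a \<in> W \<Longrightarrow> R w a"
    using assms(2) by (auto simp: W_def)
  have tot: "totalp_on U R" if "U \<subseteq> V" for U
    using assms(1) that by (auto simp: totalp_on_def)
  have cardW: "(p + 1) * (2 * p - 1) \<le> card W"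
    using w(2) large unfolding W_def[symmetric] by linarith
  let ?O = "V - insert w W"
  obtain L where L: "L \<subseteq> ?O" "card L < 2 * p" "star_tileable p R (?O - L)"
    using star_tileable_greedy[of ?O R p] tot[of ?O] assms(2,3) by auto
  \<comment> \<open>This is the source of the bound on \<open>card V\<close>: \<open>L\<close> has
    at most \<open>2 * p - 1\<close> vertices, so absorbing it asks for at most
    \<open>p * (2 * p - 1) + (2 * p - 1)\<close> vertices in \<open>W\<close>, which is exactly the
    lower bound \<open>cardW\<close>.\<close>
  have "p * card L \<le> p * (2 * p - 1)"
    using L(2) by (intro mult_le_mono2) linarith
  moreover have "(p + 1) * (2 * p - 1) = p * (2 * p - 1) + (2 * p - 1)"
    by (simp only: distrib_right mult_1_left)
  ultimately have "p * card L + 2 * p - 1 \<le> card W"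
    using cardW by linarith
  moreover have "L \<union> W \<subseteq> V" "finite L" "L \<inter> W = {}"
    using L(1) W(1) assms(2) by (auto intro: finite_subset)
  ultimately obtain B where B: "B \<subseteq> W" "star_tileable p R (L \<union> B)"
    using star_tileable_absorb[of L W R p] tot[of "L \<union> W"] assms(3) W(3) by blast
  obtain Z where Z: "Z \<subseteq> W - B" "card Z < 2 * p" "star_tileable p R (W - B - Z)"
    using star_tileable_greedy[of "W - B" R p] tot[of "W - B"] assms(3) W by blast
  let ?T = "(?O - L) \<union> (L \<union> B) \<union> (W - B - Z)"
  have T: "star_tileable p R ?T"
    using L(1) B(1) Z(1)
    by (intro star_tileable_Un[OF star_tileable_Un[OF L(3) B(2)] Z(3)]) auto
  have V: "V = insert w Z \<union> ?T"
    using w(1) L(1) B(1) Z(1) W(1) by auto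
  have disj: "insert w Z \<inter> ?T = {}"
    using L(1) B(1) Z(1) W(2) by auto
  have finZ: "finite Z" and wZ: "w \<notin> Z"
    using Z(1) W by (auto intro: finite_subset)
  have "card V = card (insert w Z) + card ?T"
    using disj finZ star_tileable_finite[OF T] by (subst V, intro card_Un_disjoint) auto
  then have "(p + 1) dvd card (insert w Z)"
    using assms(4) star_tileable_dvd_card[OF T] by (simp only: dvd_add_left_iff)
  then have "(p + 1) dvd card Z + 1"
    using finZ wZ by simp
  then obtain q where q: "card Z + 1 = (p + 1) * q"
    by (auto simp: dvd_def)
  \<comment> \<open>The number \<open>card Z + 1\<close> is a positive multiple of
    \<open>p + 1\<close> and at most \<open>2 * p\<close>, which is less than
    \<open>2 * (p + 1)\<close>. So \<open>Z\<close> has exactly the \<open>p\<close> vertices needed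
    as leaves of \<open>w\<close>.\<close>
  have "q = 1"
  proof (rule ccontr)
    assume "q \<noteq> 1"
    moreover have "q \<noteq> 0"
      using q by (cases q) auto
    ultimately have "(p + 1) * 2 \<le> (p + 1) * q"
      by (intro mult_le_mono2) linarith
    then have "(p + 1) * 2 \<le> card Z + 1"
      by (simp only: q)
    with Z(2) show False
      by simp
  qed
  then have "card Z = p"
    using q by simp
  then have "star_tileable p R (insert w Z)"
    using finZ wZ Z(1) W(4) by (intro star_tileable_star) auto
  from star_tileable_Un[OF this T disj] show ?thesis
    by (simp only: V[symmetric])
qed

section \<open>From tiled vertex sets to subgraphs\<close>

lemma (in digraph) ex_m_star_subgraph:
  assumes "c \<in> verts G" "finite A" "card A = p" "c \<notin> A" "\<And>a. a \<in> A \<Longrightarrow> c \<rightarrow> a"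
  shows "\<exists>H. subgraph H G \<and> digraph_iso (m_star (p + 1)) H \<and> verts H = insert c A"
proof -
  have "\<forall>a\<in>A. \<exists>e. e \<in> arcs G \<and> tail G e = c \<and> head G e = a"
    using assms(5) by (fastforce simp: arcs_ends_conv)
  then obtain e where e: "\<And>a. a \<in> A \<Longrightarrow> e a \<in> arcs G \<and> tail G (e a) = c \<and> head G (e a) = a"
    by metis
  obtain f where f: "bij_betw f {1..<p + 1} A"
    using assms(2,3) by (metis add_diff_cancel_right' card_atLeastLessThan finite_atLeastLessThan
        finite_same_card_bij)
  have fA: "f i \<in> A" if "i \<in> {1..<p + 1}" for i
    using f that by (auto simp: bij_betw_def)
  define H where "H = \<lparr>verts = insert c A, arcs = e ` A, tail = tail G, head = head G\<rparr>"
  \<comment> \<open>Arcs of \<open>m_star\<close> are pairs \<open>(0, i)\<close>, so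
    \<open>snd\<close> recovers the leaf index. The endpoint functions are those of \<open>G\<close>
    because \<open>app_iso\<close> must equal \<open>H\<close> as a record.\<close>
  define h where "h = \<lparr>iso_verts = \<lambda>i::nat. if i = 0 then c else f i, iso_arcs = \<lambda>x::nat \<times> nat. e (f (snd x)),
    iso_head = head G, iso_tail = tail G\<rparr>"
  have "A \<subseteq> verts G"
  proof
    fix a assume "a \<in> A"
    then show "a \<in> verts G"
      using e[of a] head_in_verts[of "e a"] by simp
  qed
  then have "subgraph H G"
    using assms(1) e wf_digraph by (auto simp: subgraph_def H_def compatible_def wf_digraph_def)
  moreover have "digraph_iso (m_star (p + 1)) H"
    unfolding digraph_iso_def
  proof (intro exI conjI)
    have inj_f: "inj_on f {1..<p + 1}"
      using f by (simp add: bij_betw_def)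
    have inj_e: "inj_on e A"
      using e by (metis inj_onI)
    show "pre_digraph.digraph_isomorphism (m_star (p + 1)) h"
      unfolding pre_digraph.digraph_isomorphism_def
    proof (intro conjI)
      show "wf_digraph (m_star (p + 1))"
        by (auto simp: wf_digraph_def m_star_def)
      show "inj_on (iso_verts h) (verts (m_star (p + 1)))"
      proof (rule inj_onI)
        fix i j assume "i \<in> verts (m_star (p + 1))" "j \<in> verts (m_star (p + 1))"
          "iso_verts h i = iso_verts h j"
        then show "i = j"
          using fA[of i] fA[of j] inj_onD[OF inj_f, of i j] assms(4)
          by (auto simp: h_def m_star_def split: if_splits)
      qed
      show "inj_on (iso_arcs h) (arcs (m_star (p + 1)))"
      proof (rule inj_onI)
        fix x y assume "x \<in> arcs (m_star (p + 1))" "y \<in> arcs (m_star (p + 1))"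
          "iso_arcs h x = iso_arcs h y"
        then show "x = y"
          using fA inj_onD[OF inj_f] inj_onD[OF inj_e]
          by (auto simp: h_def m_star_def)
      qed
      show "\<forall>a\<in>arcs (m_star (p + 1)).
          iso_verts h (tail (m_star (p + 1)) a) = iso_tail h (iso_arcs h a) \<and>
          iso_verts h (head (m_star (p + 1)) a) = iso_head h (iso_arcs h a)"
        using e fA by (auto simp: h_def m_star_def)
    qed
    have im: "f ` {1..<p + 1} = A"
      using f by (simp add: bij_betw_def)
    have "{0..<p + 1} = insert 0 {1..<p + 1}"
      by auto
    then have "iso_verts h ` verts (m_star (p + 1)) = insert c (f ` {1..<p + 1})"
      by (auto simp: h_def m_star_def)
    moreover have "iso_arcs h ` arcs (m_star (p + 1)) = e ` f ` {1..<p + 1}"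
      by (force simp: h_def m_star_def image_iff)
    ultimately show "H = app_iso h (m_star (p + 1))"
      unfolding app_iso_def im by (simp add: H_def h_def)
  qed
  ultimately show ?thesis
    by (auto simp: H_def)
qed

text \<open>Each \<open>insert\<close> step contributes one subgraph. The union of the vertex sets
  is tracked so that the factor can later be shown to be spanning.\<close>

lemma (in digraph) star_tileable_imp_m_stars:
  assumes "star_tileable p (\<lambda>u v. u \<rightarrow> v) U" "U \<subseteq> verts G"
  shows "\<exists>\<H>. finite \<H> \<and> (p + 1) * card \<H> = card U \<and>
          (\<forall>H \<in> \<H>. subgraph H G \<and> digraph_iso (m_star (p + 1)) H) \<and>
          pairwise (\<lambda>H H'. verts H \<inter> verts H' = {}) \<H> \<and> (\<Union>H\<in>\<H>. verts H) = U"
  using assms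
proof (induction rule: star_tileable.induct)
  case empty
  then show ?case
    by (intro exI[of _ "{}"]) auto
next
  case (insert U A c)
  then obtain \<H> where \<H>: "finite \<H>" "(p + 1) * card \<H> = card U"
    "\<forall>H \<in> \<H>. subgraph H G \<and> digraph_iso (m_star (p + 1)) H"
    "pairwise (\<lambda>H H'. verts H \<inter> verts H' = {}) \<H>" "(\<Union>H\<in>\<H>. verts H) = U"
    by auto
  obtain H where H: "subgraph H G" "digraph_iso (m_star (p + 1)) H" "verts H = insert c A"
    using ex_m_star_subgraph[of c A p] insert.hyps insert.prems by auto
  have disj: "verts H \<inter> verts H' = {}" if "H' \<in> \<H>" for H'
    using that \<H>(5) H(3) insert.hyps by blast
  \<comment> \<open>Otherwise \<open>verts H\<close> would be disjoint from itself, although it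
    contains \<open>c\<close>. Thus the new star really raises the cardinality by one.\<close>
  then have "H \<notin> \<H>"
    using H(3) by blast
  moreover have "card (insert c A \<union> U) = (p + 1) + card U"
    using insert.hyps by (subst card_Un_disjoint) (auto dest: star_tileable_finite)
  ultimately have "(p + 1) * card (insert H \<H>) = card (insert c A \<union> U)"
    using \<H>(1,2) by simp
  moreover have "pairwise (\<lambda>H H'. verts H \<inter> verts H' = {}) (insert H \<H>)"
    using \<H>(4) disj by (auto simp: pairwise_insert)
  ultimately show ?case
    using \<H> H by (intro exI[of _ "insert H \<H>"]) auto
qed

text \<open>All members share the endpoint functions of \<open>G\<close>, which \<open>Union\<close>
  uses as well, so every arc keeps its endpoints inside the member it comes from.\<close>

lemma (in wf_digraph) subgraph_Union:
  assumes "\<And>H. H \<in> \<H> \<Longrightarrow> subgraph H G"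
  shows "subgraph (Union \<H>) G"
proof -
  have "wf_digraph (Union \<H>)"
  proof
    fix e assume "e \<in> arcs (Union \<H>)"
    then obtain H where H: "H \<in> \<H>" "e \<in> arcs H"
      by (auto simp: Union_def)
    then have "tail G e \<in> verts H" "head G e \<in> verts H"
      using assms[OF H(1)] by (auto simp: subgraph_def compatible_def wf_digraph_def)
    then show "tail (Union \<H>) e \<in> verts (Union \<H>)" "head (Union \<H>) e \<in> verts (Union \<H>)"
      using H(1) by (auto simp: Union_def)
  qed
  then show ?thesis
    using assms wf_digraph by (fastforce simp: subgraph_def Union_def compatible_def)
qed

theorem theorem2:
  fixes m n :: nat and T :: "('a, 'b) pre_digraph"
  assumes "m \<ge> 2"
    and "m dvd n"
    and "int n > 4 * (int m)\<^sup>2 - 6 * int m"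
    and "tournament T"
    and "card (verts T) = n"
  shows "\<exists>F. m_star_factor m F T"
proof -
  interpret tournament T
    by fact
  obtain p where p: "m = p + 1" "p \<ge> 1"
    using assms(1) by (metis Suc_eq_plus1 Suc_le_D Suc_le_mono numeral_2_eq_2 One_nat_def)
  have "totalp_on (verts T) (\<lambda>u v. u \<rightarrow>\<^bsub>T\<^esub> v)"
  proof (rule totalp_onI)
    fix u v assume "u \<in> verts T" "v \<in> verts T" "u \<noteq> v"
    then show "u \<rightarrow>\<^bsub>T\<^esub> v \<or> v \<rightarrow>\<^bsub>T\<^esub> u"
      using one_direction[of u v] by blast
  qed
  \<comment> \<open>With \<open>m = p + 1\<close>, both bounds equal
    \<open>2 * m * (2 * m - 3)\<close>; \<open>p \<ge> 1\<close> makes the subtraction on naturals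
    exact.\<close>
  moreover have "int (2 * (p + 1) * (2 * p - 1)) < int n"
    using assms(3) p by (simp add: of_nat_diff power2_eq_square algebra_simps)
  then have "card (verts T) > 2 * (p + 1) * (2 * p - 1)"
    using assms(5) by linarith
  ultimately have "star_tileable p (\<lambda>u v. u \<rightarrow>\<^bsub>T\<^esub> v) (verts T)"
    using p assms(2,5) by (intro star_tileable_total) auto
  then obtain \<H> where \<H>: "finite \<H>" "m * card \<H> = n"
    "\<forall>H \<in> \<H>. subgraph H T \<and> digraph_iso (m_star m) H"
    "pairwise (\<lambda>H H'. verts H \<inter> verts H' = {}) \<H>" "(\<Union>H\<in>\<H>. verts H) = verts T"
    using star_tileable_imp_m_stars[of p "verts T"] assms(5) p(1) by auto
  have "card \<H> = n div m"
    using \<H>(2) assms(1) by (metis nonzero_mult_div_cancel_left not_numeral_le_zero)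
  moreover have "spanning (pre_digraph.Union T \<H>) T"
    using subgraph_Union[of \<H>] \<H>(3,5) by (auto simp: spanning_def Union_def)
  ultimately have "m_star_factor m (pre_digraph.Union T \<H>) T"
    unfolding m_star_factor_def using \<H> assms(2,5)
    by (intro conjI exI[of _ \<H>]) simp_all
  then show ?thesis ..
qed

end
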